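(* Let $U$ be the fixed universal self-delimiting computer, let $\Omega=\sum_{U(p)\text{ halts}}2^{-|p|}$ be its halting probability, and fix an effective encoding, as bit strings, of propositions of the form "the $k$-th bit of the base-two expansion of $\Omega$ is $b$" ($k\ge 1$, $b\in\{0,1\}$). There is a constant $c$ such that the following holds. Let $T$ be a formal theory of complexity $H(T)=N$, and suppose that every theorem of $T$ of the form "the $k$-th bit of $\Omega$ is $b$" is true. Then the number of positions $k$ for which $T$ contains a theorem "the $k$-th bit of $\Omega$ is $b$" for some $b\in\{0,1\}$ is at most $N+c$. The positions need not be consecutive, and $c$ does not depend on $T$.
   Context: A self-delimiting computer $C$ is a deterministic machine that reads its binary program one bit at a time from a one-way read-only tape, with no end-of-program marker, and itself decides when to stop reading. While computing it may display any number (possibly infinitely many) of intermediate outputs, and it may halt with a final output. For a bit string $p$, $C(p)$ is defined (halts) with value $x$ if $C$ halts with final output $x$ after having read exactly the bits of $p$. Thus the domain of $C$ is prefix-free. For computations that may never end, $p$ generates a set $S$ on $C$ if $C$ reads exactly the bits of $p$, never requests a further bit, and the set of all outputs displayed over the whole, possibly unending, computation is exactly $S$. Outputs are finite objects such as bit strings. $U$ is a fixed universal self-delimiting computer: for every self-delimiting computer $C$ there is a bit string $\pi_C$ such that for all $p$, $U$ run on the concatenation $\pi_C\,p$ performs the same computation as $C$ run on $p$ (same displayed outputs and same final output, if any). For example, $\pi_C = 0^{g}1$, where $g$ is a Gödel number for $C$. $|p|$ denotes the size in bits of $p$. In the sum defining $\Omega$, $p$ ranges over all bit strings for which $U(p)$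 halts; $\Omega$ is a real number in $(0,1)$. A formal theory $T$ is identified with its set of theorems, a recursively enumerable set of propositions encoded as bit strings. Its complexity $H(T)$ is the size in bits of the smallest program $p$ that generates on $U$ the set of all theorems of $T$. *)

theory Defs
  imports Complex_Main "HOL-Library.Nat_Bijection" "HOL-Analysis.Infinite_Sum"
begin

(* Total recursive functions on nat: tuples are coded by prod_encode, and minimization is
   only applied to regular functions, so that no partial functions are needed. *)
inductive recursive :: "(nat \<Rightarrow> nat) \<Rightarrow> bool" where
  zero: "recursive (\<lambda>_. 0)"
| suc: "recursive Suc"
| left: "recursive (\<lambda>x. fst (prod_decode x))"
| right: "recursive (\<lambda>x. snd (prod_decode x))"
| pair: "recursive f \<Longrightarrow> recursive g \<Longrightarrow> recursive (\<lambda>x. prod_encode (f x, g x))"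
| comp: "recursive f \<Longrightarrow> recursive g \<Longrightarrow> recursive (\<lambda>x. f (g x))"
| prec: "recursive f \<Longrightarrow> recursive g \<Longrightarrow>
    recursive (\<lambda>x. case prod_decode x of (a, n) \<Rightarrow>
      rec_nat (f a) (\<lambda>m r. g (prod_encode (a, prod_encode (m, r)))) n)"
| minim: "recursive f \<Longrightarrow> (\<And>x. \<exists>y. f (prod_encode (x, y)) = 0) \<Longrightarrow>
    recursive (\<lambda>x. LEAST y. f (prod_encode (x, y)) = 0)"

type_synonym bits = "bool list"

definition bits_code :: "bits \<Rightarrow> nat" where
  "bits_code x = list_encode (map of_bool x)"

definition recursively_enumerable :: "bits set \<Rightarrow> bool" where
  "recursively_enumerable A \<longleftrightarrow> A = {} \<or> (\<exists>f. recursive f \<and> bits_code ` A = range f)"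

(* What a machine does in a given internal state. "Read s0 s1" requests the next bit of the
   program tape and goes to s0 or s1 according as it is 0 or 1. *)
datatype action =
    Continue nat
  | Read nat nat
  | Display bits nat
  | Halt bits

fun action_code :: "action \<Rightarrow> nat" where
  "action_code (Continue s) = prod_encode (0, s)"
| "action_code (Read s0 s1) = prod_encode (1, prod_encode (s0, s1))"
| "action_code (Display y s) = prod_encode (2, prod_encode (bits_code y, s))"
| "action_code (Halt x) = prod_encode (3, bits_code x)"

(* The entire internal configuration of a machine (finite control and work memory) is coded
   as one natural number. The program tape is accessible only through Read. *)
datatype computer = Computer (start: nat) (action_at: "nat \<Rightarrow> action")

definition self_delimiting_computer :: "computer \<Rightarrow> bool" where
  "self_delimiting_computer C \<longleftrightarrow> recursive (\<lambda>s. action_code (action_at C s))"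

(* Starved: a bit was requested after the whole program had been read. *)
datatype status = Active nat | Starved | Halted bits

datatype config = Config (status: status) (unread: bits) (displayed: "bits list")

fun advance :: "computer \<Rightarrow> config \<Rightarrow> config" where
  "advance C (Config (Active s) r ys) =
    (case action_at C s of
       Continue s' \<Rightarrow> Config (Active s') r ys
     | Read s0 s1 \<Rightarrow>
         (case r of
            [] \<Rightarrow> Config Starved [] ys
          | b # r' \<Rightarrow> Config (Active (if b then s1 else s0)) r' ys)
     | Display y s' \<Rightarrow> Config (Active s') r (ys @ [y])
     | Halt x \<Rightarrow> Config (Halted x) r ys)"
| "advance C (Config Starved r ys) = Config Starved r ys"
| "advance C (Config (Halted x) r ys) = Config (Halted x) r ys"

definition run :: "computer \<Rightarrow> bits \<Rightarrow> nat \<Rightarrow> config" where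
  "run C p n = (advance C ^^ n) (Config (Active (start C)) p [])"

definition halts_with :: "computer \<Rightarrow> bits \<Rightarrow> bits \<Rightarrow> bool" where
  "halts_with C p x \<longleftrightarrow> (\<exists>n. status (run C p n) = Halted x \<and> unread (run C p n) = [])"

definition generates :: "computer \<Rightarrow> bits \<Rightarrow> bits set \<Rightarrow> bool" where
  "generates C p S \<longleftrightarrow>
    (\<exists>n. unread (run C p n) = []) \<and>
    (\<forall>n. status (run C p n) \<noteq> Starved) \<and>
    S = (\<Union>n. set (displayed (run C p n)))"

definition never_read :: "computer \<Rightarrow> bits \<Rightarrow> nat" where
  "never_read C p = (LEAST k. \<exists>n. length (unread (run C p n)) = k)"

(* Displayed sequences may be infinite; they are compared through the sets of their
   finite initial segments. Equality of never_read says that, when q = \<pi> @ p, the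
   computer D reads all of \<pi> and then exactly the bits of p that C reads. *)
definition same_computation :: "computer \<Rightarrow> bits \<Rightarrow> computer \<Rightarrow> bits \<Rightarrow> bool" where
  "same_computation C p D q \<longleftrightarrow>
    range (\<lambda>n. displayed (run C p n)) = range (\<lambda>n. displayed (run D q n)) \<and>
    (\<forall>x. (\<exists>n. status (run C p n) = Halted x) \<longleftrightarrow> (\<exists>n. status (run D q n) = Halted x)) \<and>
    ((\<exists>n. status (run C p n) = Starved) \<longleftrightarrow> (\<exists>n. status (run D q n) = Starved)) \<and>
    never_read C p = never_read D q"

definition universal :: "computer \<Rightarrow> bool" where
  "universal U \<longleftrightarrow> self_delimiting_computer U \<and>
    (\<forall>C. self_delimiting_computer C \<longrightarrow> (\<exists>\<pi>. \<forall>p. same_computation C p U (\<pi> @ p)))"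

definition halting_probability :: "computer \<Rightarrow> real" where
  "halting_probability U = (\<Sum>\<^sub>\<infinity>p\<in>{p. \<exists>x. halts_with U p x}. (1/2) ^ length p)"

(* The k-th digit after the binary point, for k >= 1; a dyadic rational gets its
   terminating expansion. *)
definition binary_digit :: "real \<Rightarrow> nat \<Rightarrow> bool" where
  "binary_digit x k \<longleftrightarrow> odd \<lfloor>2 ^ k * x\<rfloor>"

(* "enc k b" is the code of the proposition "the k-th bit of Omega is b". *)
definition effective_encoding :: "(nat \<Rightarrow> bool \<Rightarrow> bits) \<Rightarrow> bool" where
  "effective_encoding enc \<longleftrightarrow>
    inj_on (\<lambda>(k, b). enc k b) ({1..} \<times> UNIV) \<and>
    (\<exists>f. recursive f \<and> (\<forall>k\<ge>1. \<forall>b. f (prod_encode (k, of_bool b)) = bits_code (enc k b)))"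

(* Meaningful only for T generated by some program on U; for universal U these are the
   recursively enumerable sets. *)
definition complexity :: "computer \<Rightarrow> bits set \<Rightarrow> nat" where
  "complexity U T = (LEAST n. \<exists>p. length p = n \<and> generates U p T)"

end

theory Submission imports Defs begin

text \<open>
  Suppose that a program \<open>p\<close> for \<open>U\<close> has displayed, by step \<open>t\<^sub>0\<close>, correct digits of \<open>\<Omega>\<close> at many more
  than \<open>|p|\<close> of the positions up to \<open>t\<^sub>0\<close>. Let \<open>q\<close> list the digits at the remaining positions. A
  machine that reads \<open>p q\<close> can simulate \<open>U\<close> on \<open>p\<close>, find \<open>t\<^sub>0\<close>, ask for \<open>q\<close> and so recover
  \<open>J = \<lfloor>2\<^bsup>t\<^sub>0\<^esup> \<Omega>\<rfloor>\<close>. It then computes approximations of \<open>\<Omega>\<close> from below until one exceeds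
  \<open>(J - 1) / 2\<^bsup>t\<^sub>0\<^esup>\<close>; at that time every halting program of length at most \<open>t\<^sub>0 - 2\<close> has already halted.
  The program \<open>\<pi> 0\<^bsup>m\<^esup> 1 p q\<close> by which \<open>U\<close> imitates the machine is that short, because \<open>p\<close> displays more
  digits than it has bits, and the machine knows this program: \<open>m\<close> encodes \<open>\<pi>\<close>. So the machine halts
  precisely if its own program has not yet halted on \<open>U\<close>, which is contradictory in both cases.
\<close>

section \<open>Closure properties of the recursive functions\<close>

abbreviation pair :: "nat \<Rightarrow> nat \<Rightarrow> nat" where
  "pair x y \<equiv> prod_encode (x, y)"

abbreviation pfst :: "nat \<Rightarrow> nat" where
  "pfst z \<equiv> fst (prod_decode z)"

abbreviation psnd :: "nat \<Rightarrow> nat" where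
  "psnd z \<equiv> snd (prod_decode z)"

abbreviation decidable :: "(nat \<Rightarrow> bool) \<Rightarrow> bool" where
  "decidable P \<equiv> recursive (\<lambda>x. of_bool (P x))"

text \<open>Rules that follow the syntax of a term, so that recursiveness of later definitions can
  be read off after unfolding them.\<close>

named_theorems rec_intros

lemma recursive_ident [rec_intros]: "recursive (\<lambda>x. x)"
  using recursive.pair[OF recursive.left recursive.right] by simp

lemma recursive_pfst [rec_intros]: "recursive f \<Longrightarrow> recursive (\<lambda>x. pfst (f x))"
  by (rule recursive.comp[OF recursive.left])

lemma recursive_psnd [rec_intros]: "recursive f \<Longrightarrow> recursive (\<lambda>x. psnd (f x))"
  by (rule recursive.comp[OF recursive.right])

lemma recursive_Suc [rec_intros]: "recursive f \<Longrightarrow> recursive (\<lambda>x. Suc (f x))"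
  by (rule recursive.comp[OF recursive.suc])

lemma recursive_const [rec_intros]: "recursive (\<lambda>_. k)"
  by (induction k) (auto intro: recursive.zero recursive_Suc)

lemmas recursive_pair [rec_intros] = recursive.pair

lemma recursive_comp2:
  assumes "recursive (\<lambda>z. h (pfst z) (psnd z))" "recursive f" "recursive g"
  shows "recursive (\<lambda>x. h (f x) (g x))"
  using recursive.comp[OF assms(1) recursive.pair[OF assms(2,3)]] by simp

text \<open>Recursion runs with \<open>x\<close> itself as the parameter, so base, step and number
  of iterations may all depend on \<open>x\<close>; the step receives \<open>x\<close>, the counter
  \<open>m\<close> and the previous value \<open>r\<close> as nested pairs.\<close>

lemma recursive_rec_nat [rec_intros]:
  assumes "recursive f" "recursive (\<lambda>z. g (pfst z) (pfst (psnd z)) (psnd (psnd z)))" "recursive n"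
  shows "recursive (\<lambda>x. rec_nat (f x) (\<lambda>m r. g x m r) (n x))"
proof -
  have "recursive (\<lambda>z. rec_nat (f (pfst z)) (\<lambda>m r. g (pfst z) m r) (psnd z))"
    using recursive.prec[OF assms(1,2)] by (simp add: case_prod_unfold)
  from recursive_comp2[OF this recursive_ident assms(3)] show ?thesis .
qed

lemma recursive_funpow [rec_intros]:
  assumes "recursive h" "recursive a" "recursive n"
  shows "recursive (\<lambda>x. (h ^^ n x) (a x))"
proof -
  have eq: "(h ^^ k) y = rec_nat y (\<lambda>m r. h r) k" for k y
    by (induction k) auto
  show ?thesis
    unfolding eq by (intro rec_intros assms recursive.comp[OF assms(1)])
qed

lemma recursive_add [rec_intros]:
  assumes "recursive f" "recursive g"
  shows "recursive (\<lambda>x. f x + g x)"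
proof -
  have eq: "y + k = rec_nat y (\<lambda>m r. Suc r) k" for k y :: nat
    by (induction k) auto
  show ?thesis
    unfolding eq by (intro rec_intros assms)
qed

lemma recursive_diff [rec_intros]:
  assumes "recursive f" "recursive g"
  shows "recursive (\<lambda>x. f x - g x)"
proof -
  \<comment> \<open>The predecessor is a recursion whose step returns the counter; iterating it
    gives truncated subtraction.\<close>
  have pred: "k - 1 = rec_nat 0 (\<lambda>m r. m) k" for k :: nat
    by (cases k) auto
  have eq: "y - k = rec_nat y (\<lambda>m r. rec_nat 0 (\<lambda>m r. m) r) k" for k y :: nat
    by (induction k) (auto simp flip: pred)
  show ?thesis
    unfolding eq by (intro rec_intros assms)
qed

lemma recursive_mult [rec_intros]:
  assumes "recursive f" "recursive g"
  shows "recursive (\<lambda>x. f x * g x)"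
proof -
  have eq: "y * k = rec_nat 0 (\<lambda>m r. r + y) k" for k y :: nat
    by (induction k) auto
  show ?thesis
    unfolding eq by (intro rec_intros assms recursive.comp[OF assms(1)])
qed

lemma recursive_power [rec_intros]:
  assumes "recursive f" "recursive g"
  shows "recursive (\<lambda>x. f x ^ g x)"
proof -
  have eq: "y ^ k = rec_nat 1 (\<lambda>m r. r * y) k" for k y :: nat
    by (induction k) auto
  show ?thesis
    unfolding eq by (intro rec_intros assms recursive.comp[OF assms(1)])
qed

lemma recursive_sum [rec_intros]:
  assumes "recursive (\<lambda>z. f (pfst z) (psnd z))" "recursive n"
  shows "recursive (\<lambda>x. \<Sum>i<n x. f x i)"
proof -
  have eq: "(\<Sum>i<k. f x i) = rec_nat 0 (\<lambda>m r. r + f x m) k" for k x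
    by (induction k) auto
  show ?thesis
    unfolding eq by (intro rec_intros assms recursive_comp2[OF assms(1)])
qed

section \<open>Decidable predicates, bounded quantifiers and halving\<close>

lemma decidable_le [rec_intros]:
  assumes "recursive f" "recursive g"
  shows "decidable (\<lambda>x. f x \<le> g x)"
proof -
  have eq: "of_bool (f x \<le> g x) = 1 - (f x - g x)" for x
    by auto
  show ?thesis
    unfolding eq by (intro rec_intros assms)
qed

lemma decidable_less [rec_intros]:
  assumes "recursive f" "recursive g"
  shows "decidable (\<lambda>x. f x < g x)"
  using decidable_le[OF recursive_Suc[OF assms(1)] assms(2)] by (simp add: Suc_le_eq)

lemma decidable_not [rec_intros]:
  assumes "decidable P"
  shows "decidable (\<lambda>x. \<not> P x)"
proof -
  have eq: "of_bool (\<not> P x) = (1 - of_bool (P x) :: nat)" for x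
    by simp
  show ?thesis
    unfolding eq by (intro rec_intros assms)
qed

lemma decidable_conj [rec_intros]:
  assumes "decidable P" "decidable Q"
  shows "decidable (\<lambda>x. P x \<and> Q x)"
  using recursive_mult[OF assms] by (simp only: of_bool_conj)

lemma decidable_disj [rec_intros]:
  assumes "decidable P" "decidable Q"
  shows "decidable (\<lambda>x. P x \<or> Q x)"
  using decidable_not[OF decidable_conj[OF assms[THEN decidable_not]]] by simp

lemma decidable_eq [rec_intros]:
  assumes "recursive f" "recursive g"
  shows "decidable (\<lambda>x. f x = g x)"
  using decidable_conj[OF decidable_le[OF assms] decidable_le[OF assms(2,1)]]
  by (simp add: order_eq_iff)

lemma recursive_if [rec_intros]:
  assumes "decidable P" "recursive f" "recursive g"
  shows "recursive (\<lambda>x. if P x then f x else g x)"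
proof -
  have eq: "(if P x then f x else g x) = of_bool (P x) * f x + (1 - of_bool (P x)) * g x" for x
    by auto
  show ?thesis
    unfolding eq by (intro rec_intros assms)
qed

lemma decidable_ex_less [rec_intros]:
  assumes "decidable (\<lambda>z. P (pfst z) (psnd z))" "recursive n"
  shows "decidable (\<lambda>x. \<exists>i<n x. P x i)"
proof -
  have eq: "(\<exists>i<n x. P x i) \<longleftrightarrow> 0 < (\<Sum>i<n x. of_bool (P x i) :: nat)" for x
    by (auto simp: zero_less_iff_neq_zero simp del: sum_of_bool_eq)
  show ?thesis
    unfolding eq by (intro rec_intros assms)
qed

lemma decidable_all_less [rec_intros]:
  assumes "decidable (\<lambda>z. P (pfst z) (psnd z))" "recursive n"
  shows "decidable (\<lambda>x. \<forall>i<n x. P x i)"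
  using decidable_not[OF decidable_ex_less[OF decidable_not[OF assms(1)] assms(2)]] by simp

lemma recursive_div2 [rec_intros]:
  assumes "recursive f"
  shows "recursive (\<lambda>x. f x div 2)"
proof -
  have eq: "k div 2 = (\<Sum>i<k. of_bool (2 * Suc i \<le> k))" for k
  proof -
    have "{..<k} \<inter> {i. 2 * Suc i \<le> k} = {..<k div 2}"
      by auto
    then show ?thesis
      by simp
  qed
  show ?thesis
    unfolding eq by (intro rec_intros assms recursive.comp[OF assms])
qed

lemma recursive_mod2 [rec_intros]:
  assumes "recursive f"
  shows "recursive (\<lambda>x. f x mod 2)"
  using recursive_diff[OF assms recursive_mult[OF recursive_const[of 2] recursive_div2[OF assms]]]
  by (simp add: minus_mult_div_eq_mod)

lemma decidable_odd [rec_intros]: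
  assumes "recursive f"
  shows "decidable (\<lambda>x. odd (f x))"
  using recursive_mod2[OF assms] by (simp add: mod_2_eq_odd)

section \<open>Runs of computers\<close>

lemma run_0: "run C p 0 = Config (Active (start C)) p []"
  by (simp add: run_def)

lemma run_Suc: "run C p (Suc n) = advance C (run C p n)"
  by (simp add: run_def)

lemma run_add: "run C p (m + n) = (advance C ^^ n) (run C p m)"
  by (simp add: run_def funpow_add add.commute[of m n])

lemma run_Halted_mono:
  assumes "status (run C p m) = Halted x" "m \<le> n"
  shows "run C p n = run C p m"
  using assms(2)
proof (induction rule: dec_induct)
  case (step n)
  then show ?case
    using assms(1) by (cases "run C p m") (simp add: run_Suc)
qed simp

lemma advance_append:
  assumes "advance C (Config s r d) = Config s' r' d'" "s' \<noteq> Starved"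
  shows "advance C (Config s (r @ y) d) = Config s' (r' @ y) d'"
  using assms by (cases s) (auto split: action.splits list.splits)

text \<open>\<open>Starved\<close> is absorbing, so a run that is not starved by step
  \<open>n\<close> has never reached past the end of \<open>x\<close>, and \<open>y\<close> simply
  stays unread behind the rest.\<close>

lemma run_append:
  assumes "status (run C x n) \<noteq> Starved"
  shows "run C (x @ y) n = (case run C x n of Config s r d \<Rightarrow> Config s (r @ y) d)"
  using assms
proof (induction n)
  case 0
  then show ?case by (simp add: run_0)
next
  case (Suc n)
  obtain s r d where n: "run C x n = Config s r d"
    by (cases "run C x n")
  obtain s' r' d' where n': "advance C (Config s r d) = Config s' r' d'"
    by (cases "advance C (Config s r d)")
  have "s' \<noteq> Starved"
    using Suc.prems n n' by (simp add: run_Suc)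
  moreover from this have "s \<noteq> Starved"
    using n' by auto
  ultimately show ?case
    using Suc.IH n n' advance_append[OF n'] by (simp add: run_Suc)
qed

lemma advance_suffix: "\<exists>z. r = z @ unread (advance C (Config s r d))"
  by (cases s) (auto split: action.splits list.splits)

lemma run_suffix: "\<exists>z. p = z @ unread (run C p n)"
proof (induction n)
  case 0
  then show ?case by (simp add: run_0)
next
  case (Suc n)
  then show ?case
    using advance_suffix[of "unread (run C p n)" C "status (run C p n)" "displayed (run C p n)"]
    by (metis append.assoc config.collapse run_Suc)
qed

lemma length_unread_mono:
  "m \<le> n \<Longrightarrow> length (unread (run C p n)) \<le> length (unread (run C p m))"
proof (induction rule: dec_induct)
  case (step n)
  then show ?case
    using advance_suffix[of "unread (run C p n)" C "status (run C p n)" "displayed (run C p n)"]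
    by (metis config.collapse run_Suc length_append le_add2 le_trans)
qed simp

lemma displayed_mono:
  "m \<le> n \<Longrightarrow> set (displayed (run C p m)) \<subseteq> set (displayed (run C p n))"
proof (induction rule: dec_induct)
  case (step n)
  have "set d \<subseteq> set (displayed (advance C (Config s r d)))" for s r d
    by (cases s) (auto split: action.splits list.splits)
  with step show ?case
    by (metis config.collapse run_Suc subset_trans)
qed simp

lemma Starved_mono:
  "m \<le> n \<Longrightarrow> status (run C p m) = Starved \<Longrightarrow> status (run C p n) = Starved"
proof (induction rule: dec_induct)
  case (step n)
  then show ?case
    by (cases "run C p n") (simp add: run_Suc)
qed simp

text \<open>Converse of \<open>run_append\<close>: a run that has not touched \<open>y\<close>
  depends on \<open>x\<close> alone.\<close>

lemma run_cut:
  assumes "run C (x @ y) n = Config s (z @ y) d" "s \<noteq> Starved"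
  shows "run C x n = Config s z d"
proof -
  have *: "status (run C x n) \<noteq> Starved"
  proof
    assume "status (run C x n) = Starved"
    then obtain m where m: "status (run C x m) \<noteq> Starved" "status (run C x (Suc m)) = Starved" "m < n"
      using ex_least_nat_less[of "\<lambda>m. status (run C x m) = Starved" n] by (auto simp: run_0)
    obtain s' r' d' where "run C x m = Config s' r' d'"
      by (cases "run C x m")
    moreover from this m obtain k where "s' = Active k" "r' = []"
      "\<exists>a b. action_at C k = Read a b"
      by (cases s') (auto simp: run_Suc split: action.splits list.splits)
    \<comment> \<open>Where \<open>x\<close> alone first starves, a bit is requested with
      \<open>x\<close> used up. On \<open>x @ y\<close> the same request consumes a bit of
      \<open>y\<close>, or starves if \<open>y\<close> is empty, and neither can be undone by step
      \<open>n\<close>.\<close>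
    ultimately have "length (unread (run C (x @ y) (Suc m))) < length y \<or>
        status (run C (x @ y) (Suc m)) = Starved"
      using run_append[OF m(1), of y] by (auto simp: run_Suc split: list.splits)
    then show False
      using length_unread_mono[of "Suc m" n C "x @ y"] Starved_mono[of "Suc m" n C "x @ y"] m(3) assms
      by auto
  qed
  show ?thesis
    using run_append[OF *, of y] assms(1) by (cases "run C x n") auto
qed

text \<open>Halting and exhaustion of the tape may be witnessed at different times; both persist, so
  they hold together at the later one.\<close>

lemma halts_withI:
  assumes "status (run C p m) = Halted x" "length (unread (run C p n)) = 0"
  shows "halts_with C p x"
proof -
  have "unread (run C p (max m n)) = []"
    using length_unread_mono[of n "max m n" C p] assms(2) by simp
  then show ?thesis
    using run_Halted_mono[OF assms(1), of "max m n"] assms(1)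
    by (auto simp: halts_with_def intro!: exI[of _ "max m n"])
qed

lemma never_read_attained: "\<exists>n. length (unread (run C p n)) = never_read C p"
  unfolding never_read_def by (rule LeastI_ex) blast

lemma never_read_eq_0_iff: "never_read C p = 0 \<longleftrightarrow> (\<exists>n. unread (run C p n) = [])"
proof
  show "\<exists>n. unread (run C p n) = [] \<Longrightarrow> never_read C p = 0"
    unfolding never_read_def by (metis (mono_tags, lifting) Least_eq_0 list.size(3))
qed (use never_read_attained[of C p] in auto)

lemma same_computation_halts_with:
  assumes "same_computation C p D q" "halts_with C p x"
  shows "halts_with D q x"
proof -
  have "never_read D q = 0" "\<exists>n. status (run D q n) = Halted x"
    using assms never_read_eq_0_iff[of C p] unfolding same_computation_def halts_with_def by metis+
  then show ?thesis
    by (auto simp: never_read_eq_0_iff intro: halts_withI)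
qed

lemma same_computation_generates:
  assumes "same_computation C p D q" "generates C p S"
  shows "generates D q S"
proof -
  have "(\<lambda>d. set d) ` range (\<lambda>n. displayed (run C p n)) = (\<lambda>d. set d) ` range (\<lambda>n. displayed (run D q n))"
    using assms(1) by (simp add: same_computation_def)
  then have "(\<Union>n. set (displayed (run C p n))) = (\<Union>n. set (displayed (run D q n)))"
    by (simp add: image_image)
  moreover have "never_read D q = 0"
    using assms never_read_eq_0_iff[of C p] unfolding same_computation_def generates_def by metis
  ultimately show ?thesis
    using assms unfolding same_computation_def generates_def never_read_eq_0_iff by metis
qed

section \<open>The complexity of a recursively enumerable theory\<close>

lemma inj_bits_code: "inj bits_code"
proof (rule injI)
  fix x y
  assume "bits_code x = bits_code y"
  then have "map of_bool x = (map of_bool y :: nat list)"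
    by (simp add: bits_code_def list_encode_eq)
  moreover have "inj (of_bool :: bool \<Rightarrow> nat)"
    by (simp add: inj_on_def)
  ultimately show "x = y"
    by (simp add: inj_map_eq_map)
qed

text \<open>Makes the \<open>LEAST\<close> in \<open>complexity\<close> meaningful. A machine that
  never reads can display an enumeration, with the index as its state; \<pi> alone is then a program
  for \<open>U\<close>.\<close>

lemma universal_generates_recursively_enumerable:
  assumes "universal U" "recursively_enumerable T"
  shows "\<exists>p. generates U p T"
proof -
  have "\<exists>C. self_delimiting_computer C \<and> generates C [] T"
  proof (cases "T = {}")
    case True
    \<comment> \<open>The empty set has no enumeration; a machine that idles forever generates
      it.\<close>
    define C where "C = Computer 0 (\<lambda>s. Continue s)"
    have run: "run C [] n = Config (Active 0) [] []" for n
      by (induction n) (simp_all add: run_0 run_Suc C_def)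
    have "self_delimiting_computer C"
      by (simp add: self_delimiting_computer_def C_def) (intro rec_intros)
    with run True show ?thesis
      by (auto simp: generates_def intro!: exI[of _ C])
  next
    case False
    then obtain f where f: "recursive f" "bits_code ` T = range f"
      using assms(2) by (auto simp: recursively_enumerable_def)
    have "\<forall>n. \<exists>y. y \<in> T \<and> f n = bits_code y"
    proof
      fix n
      have "f n \<in> bits_code ` T"
        using f(2) by simp
      then show "\<exists>y. y \<in> T \<and> f n = bits_code y"
        by blast
    qed
    from choice[OF this] obtain y where y: "\<And>n. y n \<in> T" "\<And>n. f n = bits_code (y n)"
      by blast
    define C where "C = Computer 0 (\<lambda>s. Display (y s) (Suc s))"
    have run: "run C [] n = Config (Active n) [] (map y [0..<n])" for n
      by (induction n) (simp_all add: run_0 run_Suc C_def)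
    \<comment> \<open>\<open>y\<close> comes from a choice, but only \<open>bits_code (y s)\<close>
      enters the action code, and that is \<open>f s\<close>.\<close>
    have "self_delimiting_computer C"
      by (simp add: self_delimiting_computer_def C_def flip: y(2)) (intro rec_intros f(1))
    moreover have "T = range y"
      using f(2) inj_image_eq_iff[OF inj_bits_code, of T "range y"] by (simp add: image_image y(2))
    then have "generates C [] T"
    proof -
      have "(\<Union>n. y ` {0..<n}) = range y"
        by (auto intro!: image_eqI[OF refl] bexI)
      with \<open>T = range y\<close> show ?thesis
        by (auto simp: generates_def run)
    qed
    ultimately show ?thesis
      by blast
  qed
  then obtain C \<pi> where "generates C [] T" "same_computation C [] U (\<pi> @ [])"
    using assms(1) unfolding universal_def by blast
  then show ?thesis
    using same_computation_generates by blast
qed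

lemma complexity_attained:
  assumes "universal U" "recursively_enumerable T"
  shows "\<exists>p. length p = complexity U T \<and> generates U p T"
  unfolding complexity_def
  by (rule LeastI_ex) (use universal_generates_recursively_enumerable[OF assms] in blast)

section \<open>Approximation of the halting probability from below\<close>

definition halted_within :: "computer \<Rightarrow> bits \<Rightarrow> nat \<Rightarrow> bool" where
  "halted_within C p t \<longleftrightarrow> (\<exists>x. status (run C p t) = Halted x)"

text \<open>Bits may remain unread on these tapes. Their proportion among all \<open>2 ^ t\<close>
  tapes serves as the lower approximation of the halting probability.\<close>

definition halting_tapes :: "computer \<Rightarrow> nat \<Rightarrow> bits set" where
  "halting_tapes C t = {x. length x = t \<and> halted_within C x t}"

definition halting_programs :: "computer \<Rightarrow> nat \<Rightarrow> bits set" where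
  "halting_programs C t = {p. length p \<le> t \<and> halted_within C p t \<and> unread (run C p t) = []}"

lemma finite_bits_le: "finite {p :: bits. length p \<le> t}"
  using finite_lists_length_le[of "UNIV :: bool set" t] by simp

lemma finite_halting_programs: "finite (halting_programs C t)"
  by (rule finite_subset[OF _ finite_bits_le[of t]]) (auto simp: halting_programs_def)

lemma run_append_halting_program:
  assumes "p \<in> halting_programs C t"
  shows "unread (run C (p @ y) t) = y" "halted_within C (p @ y) t"
proof -
  obtain x d where "run C p t = Config (Halted x) [] d"
    using assms by (cases "run C p t") (auto simp: halting_programs_def halted_within_def)
  then show "unread (run C (p @ y) t) = y" "halted_within C (p @ y) t"
    using run_append[of C p t y] by (auto simp: halted_within_def)
qed

text \<open>The part of a tape that has been read is itself a halting program, and the rest is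
  arbitrary.\<close>

lemma halting_tapes_eq:
  "halting_tapes C t = (\<Union>p\<in>halting_programs C t. (@) p ` {y. length y = t - length p})"
proof (intro equalityI subsetI)
  fix x assume x: "x \<in> halting_tapes C t"
  obtain z where z: "x = z @ unread (run C x t)"
    using run_suffix[of x C t] by blast
  obtain v where v: "status (run C x t) = Halted v"
    using x by (auto simp: halting_tapes_def halted_within_def)
  have "run C z t = Config (Halted v) [] (displayed (run C x t))"
    by (rule run_cut[where y = "unread (run C x t)"]) (use z v in \<open>auto intro: config.expand\<close>)
  moreover have "length x = t"
    using x by (simp add: halting_tapes_def)
  ultimately have "z \<in> halting_programs C t" "length (unread (run C x t)) = t - length z"
    using arg_cong[OF z, of length] by (auto simp: halting_programs_def halted_within_def)
  then show "x \<in> (\<Union>p\<in>halting_programs C t. (@) p ` {y. length y = t - length p})"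
    using z by blast
next
  fix x assume "x \<in> (\<Union>p\<in>halting_programs C t. (@) p ` {y. length y = t - length p})"
  then show "x \<in> halting_tapes C t"
    by (auto simp: halting_tapes_def run_append_halting_program) (simp add: halting_programs_def)
qed

text \<open>A program of length \<open>l\<close> accounts for \<open>2 ^ (t - l)\<close> tapes, and
  different programs account for disjoint sets of tapes.\<close>

lemma card_halting_tapes:
  "real (card (halting_tapes C t)) / 2 ^ t = (\<Sum>p\<in>halting_programs C t. (1/2) ^ length p)"
proof -
  have "card (halting_tapes C t)
      = (\<Sum>p\<in>halting_programs C t. card ((@) p ` {y :: bits. length y = t - length p}))"
    unfolding halting_tapes_eq
  proof (rule card_UN_disjoint)
    show "\<forall>p\<in>halting_programs C t. \<forall>q\<in>halting_programs C t. p \<noteq> q \<longrightarrow>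
        (@) p ` {y. length y = t - length p} \<inter> (@) q ` {y. length y = t - length q} = {}"
    proof (intro ballI impI equals0I)
      fix p q x
      assume pq: "p \<in> halting_programs C t" "q \<in> halting_programs C t" "p \<noteq> q"
        and "x \<in> (@) p ` {y. length y = t - length p} \<inter> (@) q ` {y. length y = t - length q}"
      then obtain y z where "x = p @ y" "x = q @ z"
        by blast
      \<comment> \<open>Prefix-freeness: one tape has one unread remainder at step \<open>t\<close>,
        so \<open>y = z\<close>.\<close>
      then have "p @ y = q @ y"
        using run_append_halting_program(1)[OF pq(1), of y] run_append_halting_program(1)[OF pq(2), of z]
        by simp
      with pq(3) show False
        by simp
    qed
  next
    show "\<forall>p\<in>halting_programs C t. finite ((@) p ` {y. length y = t - length p})"
      using finite_lists_length_eq[of "UNIV :: bool set"] by simp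
  qed (rule finite_halting_programs)
  also have "\<dots> = (\<Sum>p\<in>halting_programs C t. 2 ^ (t - length p))"
    using card_lists_length_eq[of "UNIV :: bool set"] by (intro sum.cong refl) (simp add: card_image inj_on_def)
  also have "real \<dots> / 2 ^ t = (\<Sum>p\<in>halting_programs C t. (1/2) ^ length p)"
    using power_diff[of "2::real" _ t]
    by (auto simp: sum_divide_distrib halting_programs_def power_one_over intro!: sum.cong)
  finally show ?thesis .
qed

lemma card_halting_tapes_le: "real (card (halting_tapes C t)) / 2 ^ t \<le> 1"
proof -
  have "card (halting_tapes C t) \<le> card {x :: bits. length x = t}"
    by (rule card_mono) (auto simp: halting_tapes_def intro: finite_subset[OF _ finite_bits_le[of t]])
  also have "\<dots> = 2 ^ t"
    using card_lists_length_eq[of "UNIV :: bool set" t] by simp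
  finally show ?thesis
    by (simp add: divide_le_eq_1 flip: of_nat_le_iff)
qed

lemma halting_programs_subset: "halting_programs C t \<subseteq> {p. \<exists>x. halts_with C p x}"
  by (auto simp: halting_programs_def halted_within_def halts_with_def)

lemma eventually_halting_programs:
  assumes "finite F" "F \<subseteq> {p. \<exists>x. halts_with C p x}"
  shows "\<exists>t0. \<forall>t\<ge>t0. F \<subseteq> halting_programs C t"
  using assms
proof (induction F)
  case (insert p F)
  then obtain t0 where t0: "\<And>t. t \<ge> t0 \<Longrightarrow> F \<subseteq> halting_programs C t"
    by auto
  from insert obtain x n where n: "status (run C p n) = Halted x" "unread (run C p n) = []"
    by (auto simp: halts_with_def)
  have "insert p F \<subseteq> halting_programs C t" if "t \<ge> max (max t0 n) (length p)" for t
    using that t0[of t] n run_Halted_mono[OF n(1), of t]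
    by (auto simp: halting_programs_def halted_within_def)
  then show ?case
    by blast
qed simp

text \<open>Kraft's inequality: at a late enough stage all of \<open>F\<close> is counted by
  tapes.\<close>

lemma sum_halting_le_1:
  assumes "finite F" "F \<subseteq> {p. \<exists>x. halts_with C p x}"
  shows "(\<Sum>p\<in>F. (1/2 :: real) ^ length p) \<le> 1"
proof -
  obtain t where "F \<subseteq> halting_programs C t"
    using eventually_halting_programs[OF assms] by blast
  then have "(\<Sum>p\<in>F. (1/2 :: real) ^ length p) \<le> (\<Sum>p\<in>halting_programs C t. (1/2) ^ length p)"
    by (intro sum_mono2 finite_halting_programs) auto
  with card_halting_tapes_le[of C t] show ?thesis
    by (simp add: card_halting_tapes)
qed

text \<open>Guarantees that the infinite sum is a genuine one and not the default value 0.\<close>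

lemma halting_summable: "(\<lambda>p. (1/2 :: real) ^ length p) summable_on {p. \<exists>x. halts_with C p x}"
  by (intro nonneg_bdd_above_summable_on bdd_aboveI[of _ 1])
    (use sum_halting_le_1[of _ C] in auto)

lemma halting_probability_le_1: "halting_probability C \<le> 1"
  unfolding halting_probability_def
  by (rule infsum_le_finite_sums[OF halting_summable]) (use sum_halting_le_1[of _ C] in auto)

lemma halting_probability_nonneg: "0 \<le> halting_probability C"
  unfolding halting_probability_def by (rule infsum_nonneg) auto

lemma sum_le_halting_probability:
  assumes "finite F" "F \<subseteq> {p. \<exists>x. halts_with C p x}"
  shows "(\<Sum>p\<in>F. (1/2) ^ length p) \<le> halting_probability C"
  unfolding halting_probability_def by (rule finite_sum_le_infsum[OF halting_summable assms]) auto

text \<open>A program that halts only after step \<open>t\<close> still has its weight to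
  contribute. Hence an approximation closer than that weight certifies that the program has already
  halted.\<close>

lemma uncounted_program_le_halting_probability:
  assumes "halts_with C p x" "\<not> halted_within C p t"
  shows "real (card (halting_tapes C t)) / 2 ^ t + (1/2) ^ length p \<le> halting_probability C"
proof -
  have "p \<notin> halting_programs C t"
    using assms(2) by (simp add: halting_programs_def)
  then have "real (card (halting_tapes C t)) / 2 ^ t + (1/2) ^ length p
      = (\<Sum>p\<in>insert p (halting_programs C t). (1/2) ^ length p)"
    by (simp add: card_halting_tapes finite_halting_programs)
  also have "\<dots> \<le> halting_probability C"
    using assms(1) halting_programs_subset[of C t] finite_halting_programs[of C t]
    by (intro sum_le_halting_probability) auto
  finally show ?thesis .
qed

lemma halting_probability_approx:
  assumes "e > 0"
  shows "\<exists>t0. \<forall>t\<ge>t0. halting_probability C - e < real (card (halting_tapes C t)) / 2 ^ t"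
proof -
  have "\<exists>F. finite F \<and> F \<subseteq> {p. \<exists>x. halts_with C p x} \<and>
    halting_probability C - e < (\<Sum>p\<in>F. (1/2) ^ length p)"
  \<comment> \<open>Otherwise every finite partial sum, and with them the infinite sum, would fall
    short by \<open>e\<close>.\<close>
  proof (rule ccontr)
    assume *: "\<not> ?thesis"
    have "(\<Sum>p\<in>F. (1/2) ^ length p) \<le> halting_probability C - e"
      if "finite F" "F \<subseteq> {p. \<exists>x. halts_with C p x}" for F
      using * that not_le by blast
    from infsum_le_finite_sums[OF halting_summable[of C] this] assms show False
      by (simp add: halting_probability_def)
  qed
  then obtain F where F: "finite F" "F \<subseteq> {p. \<exists>x. halts_with C p x}"
    "halting_probability C - e < (\<Sum>p\<in>F. (1/2) ^ length p)"
    by blast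
  obtain t0 where t0: "\<And>t. t \<ge> t0 \<Longrightarrow> F \<subseteq> halting_programs C t"
    using eventually_halting_programs[OF F(1,2)] by blast
  have "(\<Sum>p\<in>F. (1/2 :: real) ^ length p) \<le> real (card (halting_tapes C t)) / 2 ^ t" if "t \<ge> t0" for t
    unfolding card_halting_tapes by (intro sum_mono2 finite_halting_programs t0 that) auto
  with F(3) show ?thesis
    by (meson less_le_trans)
qed

section \<open>Numbers as tapes\<close>

text \<open>The leading binary digit 1 marks the end of the tape; the next bit to be read is the lowest digit.\<close>

primrec tape_code :: "bits \<Rightarrow> nat" where
  "tape_code [] = 1"
| "tape_code (b # x) = of_bool b + 2 * tape_code x"

text \<open>The position of the leading binary digit of a positive \<open>n\<close>, as a bounded
  sum.\<close>

definition tape_length :: "nat \<Rightarrow> nat" where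
  "tape_length n = (\<Sum>i<n. of_bool (2 ^ Suc i \<le> n))"

lemma tape_code_bounds: "2 ^ length x \<le> tape_code x" "tape_code x < 2 ^ Suc (length x)"
  by (induction x) auto

lemma tape_code_pos: "0 < tape_code x"
  by (induction x) auto

lemma tape_code_less_2_iff: "tape_code x < 2 \<longleftrightarrow> x = []"
  using tape_code_pos by (cases x) (auto simp: Suc_le_eq)

text \<open>The end marker \<open>2 ^ length x\<close> of \<open>x\<close> gives way to the shifted
  code of \<open>y\<close>.\<close>

lemma tape_code_append: "tape_code (x @ y) + 2 ^ length x = tape_code x + 2 ^ length x * tape_code y"
  by (induction x) (auto simp: algebra_simps)

lemma tape_code_replicate_False: "tape_code (replicate n False @ x) = 2 ^ n * tape_code x"
  by (induction n) auto

text \<open>Moving the end marker up by one place adds \<open>2 ^ length x\<close>, and a new bit 1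
  adds the same again.\<close>

lemma tape_code_snoc: "tape_code (x @ [b]) = tape_code x + (if b then 2 else 1) * 2 ^ length x"
  using tape_code_append[of x "[b]"] by (auto simp: algebra_simps)

lemma tape_length_tape_code: "tape_length (tape_code x) = length x"
proof -
  have "2 ^ Suc i \<le> tape_code x \<longleftrightarrow> i < length x" for i
  proof
    assume "2 ^ Suc i \<le> tape_code x"
    then have "(2::nat) ^ Suc i < 2 ^ Suc (length x)"
      using tape_code_bounds(2)[of x] by linarith
    then show "i < length x"
      by (simp add: power_strict_increasing_iff)
  next
    assume "i < length x"
    then have "(2::nat) ^ Suc i \<le> 2 ^ length x"
      by (intro power_increasing) auto
    then show "2 ^ Suc i \<le> tape_code x"
      using tape_code_bounds(1)[of x] by linarith
  qed
  moreover have "length x < tape_code x"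
    using tape_code_bounds(1)[of x] less_exp[of "length x"] by linarith
  then have "{..<tape_code x} \<inter> {i. i < length x} = {..<length x}"
    by auto
  ultimately show ?thesis
    unfolding tape_length_def by simp
qed

lemma tape_code_inject: "tape_code x = tape_code y \<longleftrightarrow> x = y"
proof (induction x arbitrary: y)
  case Nil
  then show ?case
    using tape_code_less_2_iff[of y] by (cases y) auto
next
  case (Cons a x)
  show ?case
  proof (cases y)
    case Nil
    then show ?thesis
      using tape_code_less_2_iff[of "a # x"] by auto
  next
    case (Cons b z)
    have "of_bool a + 2 * n = of_bool b + 2 * k \<longleftrightarrow> a = b \<and> n = k" for n k :: nat
      by (cases a; cases b; simp; presburger)
    with Cons show ?thesis
      by (simp add: Cons.IH)
  qed
qed

lemma tape_code_surj: "0 < n \<Longrightarrow> \<exists>x. tape_code x = n"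
proof (induction n rule: less_induct)
  case (less n)
  show ?case
  proof (cases "n = 1")
    case True
    then show ?thesis
      by (intro exI[of _ "[]"]) simp
  next
    case False
    with less obtain x where "tape_code x = n div 2"
      by fastforce
    then have "tape_code (odd n # x) = n"
      by simp
    then show ?thesis
      by blast
  qed
qed

text \<open>Turns counting over tapes into a sum over an interval of numbers.\<close>

lemma bij_betw_tape_code: "bij_betw tape_code {x. length x = t} {2 ^ t..<2 ^ Suc t}"
proof (intro bij_betw_imageI inj_onI)
  show "tape_code ` {x. length x = t} = {2 ^ t..<2 ^ Suc t}"
  proof (intro equalityI subsetI)
    fix n :: nat
    assume n: "n \<in> {2 ^ t..<2 ^ Suc t}"
    then have "0 < n"
      by (metis atLeastLessThan_iff less_le_trans pos2 zero_less_power)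
    then obtain x where x: "tape_code x = n"
      using tape_code_surj by blast
    with n tape_code_bounds[of x] have "(2::nat) ^ t < 2 ^ Suc (length x)" "(2::nat) ^ length x < 2 ^ Suc t"
      by simp_all
    then have "t < Suc (length x)" "length x < Suc t"
      by (simp_all only: power_strict_increasing_iff one_less_numeral_iff semiring_norm)
    with x show "n \<in> tape_code ` {x. length x = t}"
      by auto
  qed (use tape_code_bounds in auto)
qed (simp add: tape_code_inject)

text \<open>The displayed outputs are dropped: they are recovered from the states visited.\<close>

definition config_code :: "config \<Rightarrow> nat" where
  "config_code c = pair (case status c of Active s \<Rightarrow> s + 2 | Starved \<Rightarrow> 0 | Halted _ \<Rightarrow> 1)
     (tape_code (unread c))"

lemma config_code_simps:
  "pfst (config_code c) = 0 \<longleftrightarrow> status c = Starved"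
  "pfst (config_code c) = 1 \<longleftrightarrow> (\<exists>x. status c = Halted x)"
  "psnd (config_code c) = tape_code (unread c)"
  by (cases "status c"; simp add: config_code_def)+

lemma recursive_tape_length [rec_intros]:
  assumes "recursive f"
  shows "recursive (\<lambda>x. tape_length (f x))"
  unfolding tape_length_def by (intro rec_intros assms[THEN recursive.comp])

section \<open>The diagonal machine\<close>

locale omega_theory =
  fixes U :: computer and enc :: "nat \<Rightarrow> bool \<Rightarrow> bits" and e :: "nat \<Rightarrow> nat"
  assumes self_delimiting: "self_delimiting_computer U"
    and recursive_e: "recursive e"
    and e_pair: "\<And>k b. k \<ge> 1 \<Longrightarrow> e (pair k (of_bool b)) = bits_code (enc k b)"
begin

section \<open>Arithmetization of \<open>U\<close> and of the machine's tests\<close>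

definition acode :: "nat \<Rightarrow> nat" where
  "acode s = action_code (action_at U s)"

text \<open>This is \<open>advance\<close> on configuration codes. First components 0 and 1 mean
  starved and halted, active states are shifted by 2; a tape code below 2 is an exhausted tape, and
  \<open>odd\<close> and \<open>div 2\<close> split off the next bit.\<close>

definition step :: "nat \<Rightarrow> nat" where
  "step z =
    (if pfst z < 2 then z
     else if pfst (acode (pfst z - 2)) = 0 then pair (psnd (acode (pfst z - 2)) + 2) (psnd z)
     else if pfst (acode (pfst z - 2)) = 1 then
       if psnd z < 2 then pair 0 (psnd z)
       else pair ((if odd (psnd z) then psnd (psnd (acode (pfst z - 2)))
                   else pfst (psnd (acode (pfst z - 2)))) + 2) (psnd z div 2)
     else if pfst (acode (pfst z - 2)) = 2 then pair (psnd (psnd (acode (pfst z - 2))) + 2) (psnd z)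
     else pair 1 (psnd z))"

definition sim :: "nat \<Rightarrow> nat \<Rightarrow> nat" where
  "sim v t = (step ^^ t) (pair (start U + 2) v)"

text \<open>Concerns the step about to be taken from \<open>z\<close>; the output is on record one
  step later, whence the strict bound \<open>i < t\<close> in \<open>known\<close>.\<close>

definition displays :: "nat \<Rightarrow> nat \<Rightarrow> bool" where
  "displays z y \<longleftrightarrow> 2 \<le> pfst z \<and> pfst (acode (pfst z - 2)) = 2 \<and>
     pfst (psnd (acode (pfst z - 2))) = y"

definition known :: "nat \<Rightarrow> nat \<Rightarrow> nat \<Rightarrow> nat \<Rightarrow> bool" where
  "known v t k b \<longleftrightarrow> (\<exists>i<t. displays (sim v i) (e (pair k b)))"

definition determined :: "nat \<Rightarrow> nat \<Rightarrow> nat \<Rightarrow> bool" where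
  "determined v t k \<longleftrightarrow> 1 \<le> k \<and> (known v t k 0 \<or> known v t k 1)"

text \<open>Only positions up to \<open>t\<close> count: together with the missing ones they make up
  the \<open>t + 1\<close> digits of \<open>\<lfloor>2 ^ t * \<Omega>\<rfloor>\<close>.\<close>

definition count :: "nat \<Rightarrow> nat \<Rightarrow> nat" where
  "count v t = (\<Sum>k<Suc t. of_bool (determined v t k))"

text \<open>The parameter \<open>m\<close> is \<open>pair a (length \<pi>)\<close> with \<open>tape_code \<pi> = a + 2 ^ length \<pi>\<close>. The length of
  the header \<open>\<pi> 0\<^bsup>m\<^esup> 1\<close> is thus \<open>psnd m + m + 1\<close>, and the surplus demanded here leaves room for it.\<close>

definition critical :: "nat \<Rightarrow> nat \<Rightarrow> nat \<Rightarrow> bool" where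
  "critical m v t \<longleftrightarrow> pfst (sim v t) \<noteq> 0 \<and>
     tape_length v + (m + psnd m + 4) \<le> count v t + tape_length (psnd (sim v t))"

text \<open>Yields \<open>Suc t\<close> if no stage up to \<open>t\<close> is critical.\<close>

definition first_critical :: "nat \<Rightarrow> nat \<Rightarrow> nat \<Rightarrow> nat" where
  "first_critical m v t = (\<Sum>i<Suc t. of_bool (\<forall>j<Suc i. \<not> critical m v j))"

text \<open>Position 0 is never determined, so the integer part of \<open>\<Omega>\<close> is always taken from \<open>q\<close>; hence \<open>\<Omega> = 1\<close>
  needs no special treatment.\<close>

definition assemble :: "nat \<Rightarrow> nat \<Rightarrow> nat \<Rightarrow> nat \<Rightarrow> nat" where
  "assemble v t q n = rec_nat (pair 0 q)
     (\<lambda>k z. if determined v t k then pair (2 * pfst z + of_bool (known v t k 1)) (psnd z)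
            else pair (2 * pfst z + psnd z mod 2) (psnd z div 2)) n"

text \<open>The numbers \<open>2 ^ t + n\<close> are the codes of all tapes of length
  \<open>t\<close>.\<close>

definition tapes :: "nat \<Rightarrow> nat" where
  "tapes t = (\<Sum>n<2 ^ t. of_bool (pfst (sim (2 ^ t + n) t) = 1))"

text \<open>The code of \<pi>, \<open>m\<close> zeros, a one and the tape \<open>v\<close>: powers
  of two shift, \<open>1 + 2 * v\<close> prepends the one, and \<open>pfst m\<close> is the code of
  \<pi> without its end marker.\<close>

definition own_program :: "nat \<Rightarrow> nat \<Rightarrow> nat" where
  "own_program m v = pfst m + 2 ^ psnd m * (2 ^ m * (1 + 2 * v))"

text \<open>Decisions: 0 continues, 1 reads a bit, 2 halts.\<close>

definition final_decision :: "nat \<Rightarrow> nat \<Rightarrow> nat \<Rightarrow> nat \<Rightarrow> nat" where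
  "final_decision m v t i =
    (if tape_length (psnd (sim v i)) + count v i < Suc i then 1
     else if pfst (assemble v i (psnd (sim v i)) (Suc i)) * 2 ^ t < tapes t * 2 ^ i + 2 ^ t \<and>
       pfst (sim (own_program m v) t) \<noteq> 1 then 2
     else 0)"

definition decision :: "nat \<Rightarrow> nat \<Rightarrow> nat \<Rightarrow> nat" where
  "decision m v t =
    (if first_critical m v t \<le> t then final_decision m v t (first_critical m v t)
     else if pfst (sim v t) = 0 then 1 else 0)"

text \<open>No tape has code 0, so \<open>v = 0\<close> marks the phase in which the zeros of the header are counted. After
  each bit read the simulation starts again at time 0.\<close>

definition diag_action :: "nat \<Rightarrow> nat \<Rightarrow> nat \<Rightarrow> action" where
  "diag_action m v t =
    (if v = 0 then Read (pair (Suc m) (pair 0 0)) (pair m (pair 1 0))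
     else if decision m v t = 0 then Continue (pair m (pair v (Suc t)))
     else if decision m v t = 1 then
       Read (pair m (pair (v + 2 ^ tape_length v) 0)) (pair m (pair (v + 2 * 2 ^ tape_length v) 0))
     else Halt [])"

text \<open>A state holds the header count \<open>m\<close>, the code \<open>v\<close> of the bits
  read after the header, and the simulated time \<open>t\<close>.\<close>

definition diag :: computer where
  "diag = Computer (pair 0 (pair 0 0)) (\<lambda>s. diag_action (pfst s) (pfst (psnd s)) (psnd (psnd s)))"

section \<open>Recursiveness of the diagonal machine\<close>

lemma recursive_acode [rec_intros]: "recursive f \<Longrightarrow> recursive (\<lambda>x. acode (f x))"
  using self_delimiting unfolding self_delimiting_computer_def acode_def
  by (rule recursive.comp)

lemma recursive_step [rec_intros]: "recursive f \<Longrightarrow> recursive (\<lambda>x. step (f x))"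
  unfolding step_def by (intro rec_intros)

lemma recursive_sim [rec_intros]:
  assumes "recursive f" "recursive g"
  shows "recursive (\<lambda>x. sim (f x) (g x))"
  unfolding sim_def by (intro rec_intros assms)

lemma decidable_displays [rec_intros]:
  assumes "recursive f" "recursive g"
  shows "decidable (\<lambda>x. displays (f x) (g x))"
  unfolding displays_def by (intro rec_intros assms)

lemma decidable_known [rec_intros]:
  assumes "recursive f" "recursive g" "recursive h" "recursive k"
  shows "decidable (\<lambda>x. known (f x) (g x) (h x) (k x))"
  unfolding known_def by (intro rec_intros assms[THEN recursive.comp] recursive_e[THEN recursive.comp])

lemma decidable_determined [rec_intros]:
  assumes "recursive f" "recursive g" "recursive h"
  shows "decidable (\<lambda>x. determined (f x) (g x) (h x))"
  unfolding determined_def by (intro rec_intros assms)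

lemma recursive_count [rec_intros]:
  assumes "recursive f" "recursive g"
  shows "recursive (\<lambda>x. count (f x) (g x))"
  unfolding count_def by (intro rec_intros assms[THEN recursive.comp])

lemma decidable_critical [rec_intros]:
  assumes "recursive f" "recursive g" "recursive h"
  shows "decidable (\<lambda>x. critical (f x) (g x) (h x))"
  unfolding critical_def by (intro rec_intros assms)

lemma recursive_first_critical [rec_intros]:
  assumes "recursive f" "recursive g" "recursive h"
  shows "recursive (\<lambda>x. first_critical (f x) (g x) (h x))"
  unfolding first_critical_def by (intro rec_intros assms[THEN recursive.comp])

lemma recursive_assemble [rec_intros]:
  assumes "recursive f" "recursive g" "recursive h" "recursive k"
  shows "recursive (\<lambda>x. assemble (f x) (g x) (h x) (k x))"
  unfolding assemble_def by (intro rec_intros assms[THEN recursive.comp])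

lemma recursive_tapes [rec_intros]:
  assumes "recursive f"
  shows "recursive (\<lambda>x. tapes (f x))"
  unfolding tapes_def by (intro rec_intros assms[THEN recursive.comp])

lemma recursive_decision [rec_intros]:
  assumes "recursive f" "recursive g" "recursive h"
  shows "recursive (\<lambda>x. decision (f x) (g x) (h x))"
  unfolding decision_def final_decision_def own_program_def by (intro rec_intros assms)

lemma self_delimiting_diag: "self_delimiting_computer diag"
proof -
  have "recursive (\<lambda>s. action_code (diag_action (pfst s) (pfst (psnd s)) (psnd (psnd s))))"
    unfolding diag_action_def if_distrib[of action_code] action_code.simps by (intro rec_intros)
  then show ?thesis
    by (simp add: self_delimiting_computer_def diag_def)
qed

section \<open>Correctness of the arithmetization\<close>

lemma step_config_code: "step (config_code c) = config_code (advance U c)"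
proof (cases c)
  case (Config s r d)
  show ?thesis
  proof (cases s)
    case (Active k)
    then show ?thesis
      using Config tape_code_less_2_iff[of r]
      by (cases "action_at U k"; cases r)
        (auto simp: config_code_def step_def acode_def)
  qed (simp_all add: Config config_code_def step_def)
qed

lemma sim_tape_code: "sim (tape_code p) t = config_code (run U p t)"
proof (induction t)
  case 0
  then show ?case
    by (simp add: sim_def run_0 config_code_def)
next
  case (Suc t)
  then show ?case
    by (simp add: sim_def run_Suc step_config_code)
qed

lemma displays_config_code:
  "displays (config_code c) (bits_code y) \<longleftrightarrow>
    (\<exists>s s'. status c = Active s \<and> action_at U s = Display y s')"
proof (cases "status c")
  case (Active s)
  then show ?thesis
    using inj_bits_code
    by (cases "action_at U s") (auto simp: displays_def config_code_def acode_def inj_eq)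
qed (simp_all add: displays_def config_code_def)

lemma displayed_iff:
  "y \<in> set (displayed (run U p t)) \<longleftrightarrow> (\<exists>i<t. displays (sim (tape_code p) i) (bits_code y))"
proof (induction t)
  case 0
  then show ?case
    by (simp add: run_0)
next
  case (Suc t)
  have "y \<in> set (displayed (advance U c)) \<longleftrightarrow>
      y \<in> set (displayed c) \<or> displays (config_code c) (bits_code y)" for c
    unfolding displays_config_code
    by (cases c; cases "status c") (auto split: action.splits list.splits)
  with Suc show ?case
    by (auto simp: run_Suc sim_tape_code less_Suc_eq)
qed

lemma known_iff:
  "k \<ge> 1 \<Longrightarrow> known (tape_code p) t k (of_bool b) \<longleftrightarrow> enc k b \<in> set (displayed (run U p t))"
  unfolding known_def displayed_iff by (simp add: e_pair)

lemma determined_iff: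
  "determined (tape_code p) t k \<longleftrightarrow> k \<ge> 1 \<and> (\<exists>b. enc k b \<in> set (displayed (run U p t)))"
  using known_iff[of k p t True] known_iff[of k p t False]
  by (auto simp: determined_def ex_bool_eq)

lemma count_eq: "count v t = card {k. k \<le> t \<and> determined v t k}"
proof -
  have "{..<Suc t} \<inter> {k. determined v t k} = {k. k \<le> t \<and> determined v t k}"
    by auto
  then show ?thesis
    unfolding count_def by (simp del: sum.lessThan_Suc)
qed

lemma tapes_eq: "tapes t = card (halting_tapes U t)"
proof -
  have "tapes t = (\<Sum>n\<in>{2 ^ t..<2 ^ Suc t}. of_bool (pfst (sim n t) = 1))"
    unfolding tapes_def
    by (rule sum.reindex_bij_witness[of _ "\<lambda>n. n - 2 ^ t" "\<lambda>n. 2 ^ t + n"]) auto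
  also have "\<dots> = (\<Sum>x | length x = t. of_bool (pfst (sim (tape_code x) t) = 1))"
    by (rule sum.reindex_bij_betw[OF bij_betw_tape_code, symmetric])
  also have "\<dots> = card ({x :: bits. length x = t} \<inter> {x. halted_within U x t})"
    using finite_lists_length_eq[of "UNIV :: bool set" t]
    by (simp add: sim_tape_code config_code_simps(2)[unfolded One_nat_def] halted_within_def)
  also have "\<dots> = card (halting_tapes U t)"
    by (rule arg_cong[of _ _ card]) (auto simp: halting_tapes_def)
  finally show ?thesis .
qed

lemma own_program_eq:
  assumes "m = pair (tape_code \<pi> - 2 ^ length \<pi>) (length \<pi>)"
  shows "own_program m (tape_code x) = tape_code (\<pi> @ replicate m False @ True # x)"
  \<comment> \<open>The lower bound on \<open>tape_code \<pi>\<close> makes the truncated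
    subtraction in \<open>m\<close> exact.\<close>
  using tape_code_append[of \<pi> "replicate m False @ True # x"] tape_code_bounds(1)[of \<pi>] assms
  by (simp add: own_program_def tape_code_replicate_False)

section \<open>Runs of the diagonal machine\<close>

abbreviation diag_config :: "nat \<Rightarrow> nat \<Rightarrow> nat \<Rightarrow> bits \<Rightarrow> config" where
  "diag_config m v t x \<equiv> Config (Active (pair m (pair v t))) x []"

text \<open>The first decision other than waiting, with \<open>u\<close> read after the header, is
  to ask for one more bit.\<close>

definition reads_on :: "nat \<Rightarrow> bits \<Rightarrow> bool" where
  "reads_on m u \<longleftrightarrow> (\<exists>t. decision m (tape_code u) t = 1 \<and> (\<forall>i<t. decision m (tape_code u) i = 0))"

lemma run_diag_zeros: "run diag (replicate m False @ y) m = diag_config m 0 0 y"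
proof (induction m arbitrary: y)
  case 0
  then show ?case
    by (simp add: run_0 diag_def)
next
  case (Suc m)
  have "replicate (Suc m) False @ y = replicate m False @ (False # y)"
    by (simp add: replicate_app_Cons_same)
  then show ?case
    by (simp only: run_Suc Suc) (simp add: diag_def diag_action_def)
qed

lemma run_diag_header: "run diag (replicate m False @ True # x) (Suc m) = diag_config m (tape_code []) 0 x"
  by (simp add: run_Suc run_diag_zeros) (simp add: diag_def diag_action_def)

lemma diag_continue:
  assumes "\<forall>i<t. decision m (tape_code u) i = 0"
  shows "(advance diag ^^ t) (diag_config m (tape_code u) 0 x) = diag_config m (tape_code u) t x"
  using assms
proof (induction t)
  case (Suc t)
  then show ?case
    using tape_code_pos[of u] by (simp add: diag_def diag_action_def)
qed simp

lemma diag_read: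
  assumes "reads_on m u"
  shows "\<exists>n. (advance diag ^^ n) (diag_config m (tape_code u) 0 (b # x))
    = diag_config m (tape_code (u @ [b])) 0 x"
proof -
  obtain t where t: "decision m (tape_code u) t = 1" "\<forall>i<t. decision m (tape_code u) i = 0"
    using assms by (auto simp: reads_on_def)
  have "(advance diag ^^ Suc t) (diag_config m (tape_code u) 0 (b # x))
    = diag_config m (tape_code (u @ [b])) 0 x"
    using diag_continue[OF t(2), of "b # x"] t(1) tape_code_pos[of u]
    by (simp add: diag_def diag_action_def tape_code_snoc tape_length_tape_code)
  then show ?thesis
    by blast
qed

lemma run_diag_reads:
  assumes "\<forall>u b y. x = u @ b # y \<longrightarrow> reads_on m u"
  shows "\<exists>n. run diag (replicate m False @ True # x) n = diag_config m (tape_code x) 0 []"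
proof -
  have "\<exists>n. run diag (replicate m False @ True # x) n = diag_config m (tape_code u) 0 y"
    if "x = u @ y" for u y
    using that
  proof (induction u arbitrary: y rule: rev_induct)
    case Nil
    then show ?case
      using run_diag_header by auto
  next
    case (snoc b u)
    then obtain n where n: "run diag (replicate m False @ True # x) n = diag_config m (tape_code u) 0 (b # y)"
      by auto
    have "reads_on m u"
      using assms snoc.prems by simp
    from diag_read[OF this] n show ?case
      by (metis run_add)
  qed
  from this[of x "[]"] show ?thesis
    by simp
qed

lemma diag_halts:
  assumes "\<forall>u b y. x = u @ b # y \<longrightarrow> reads_on m u"
    and "decision m (tape_code x) t = 2" "\<forall>i<t. decision m (tape_code x) i = 0"
  shows "halts_with diag (replicate m False @ True # x) []"
proof -
  obtain n where n: "run diag (replicate m False @ True # x) n = diag_config m (tape_code x) 0 []"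
    using run_diag_reads[OF assms(1)] by blast
  have "run diag (replicate m False @ True # x) (n + Suc t) = Config (Halted []) [] []"
    using diag_continue[OF assms(3), of "[]"] assms(2) tape_code_pos[of x] n
    by (simp only: run_add funpow.simps comp_apply) (simp add: diag_def diag_action_def)
  then show ?thesis
    unfolding halts_with_def by (metis config.sel(1,2))
qed

lemma diag_never_halts:
  assumes "\<forall>u b y. x = u @ b # y \<longrightarrow> reads_on m u"
    and "\<And>t. decision m (tape_code x) t = 0"
  shows "status (run diag (replicate m False @ True # x) k) \<noteq> Halted z"
proof
  assume k: "status (run diag (replicate m False @ True # x) k) = Halted z"
  obtain n where n: "run diag (replicate m False @ True # x) n = diag_config m (tape_code x) 0 []"
    using run_diag_reads[OF assms(1)] by blast
  \<comment> \<open>Halting by step \<open>k\<close> would persist to step \<open>n + k\<close>,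
    where the machine is still counting.\<close>
  have "run diag (replicate m False @ True # x) (n + k) = diag_config m (tape_code x) k []"
    using diag_continue[of k m x "[]"] assms(2) n by (simp add: run_add)
  then have "status (run diag (replicate m False @ True # x) (n + k)) = Active (pair m (pair (tape_code x) k))"
    by simp
  with run_Halted_mono[OF k, of "n + k"] k show False
    by simp
qed

section \<open>Behaviour of the diagonal machine on the programs it is built for\<close>

text \<open>What is computed from \<open>x\<close> before \<open>U\<close> starves stays valid when
  more bits are read, although the simulation restarts after each of them.\<close>

lemma sim_append:
  assumes "pfst (sim (tape_code x) t) \<noteq> 0"
  shows "pfst (sim (tape_code (x @ y)) t) = pfst (sim (tape_code x) t)"
    and "psnd (sim (tape_code (x @ y)) t) = tape_code (unread (run U x t) @ y)"
proof -
  have "status (run U x t) \<noteq> Starved"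
    using assms by (simp add: sim_tape_code config_code_simps(1) del: not_gr_zero)
  from run_append[OF this, of y]
  show "pfst (sim (tape_code (x @ y)) t) = pfst (sim (tape_code x) t)"
    "psnd (sim (tape_code (x @ y)) t) = tape_code (unread (run U x t) @ y)"
    by (cases "run U x t"; simp add: sim_tape_code config_code_def)+
qed

lemma sim_not_starved_mono:
  "pfst (sim (tape_code x) t) \<noteq> 0 \<Longrightarrow> i \<le> t \<Longrightarrow> pfst (sim (tape_code x) i) \<noteq> 0"
  using Starved_mono[of i t U x] by (auto simp: sim_tape_code config_code_simps)

lemma known_append:
  assumes "pfst (sim (tape_code x) t) \<noteq> 0"
  shows "known (tape_code (x @ y)) t k b = known (tape_code x) t k b"
  using sim_append(1)[OF sim_not_starved_mono[OF assms]] by (auto simp: known_def displays_def)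

lemma determined_append:
  assumes "pfst (sim (tape_code x) t) \<noteq> 0"
  shows "determined (tape_code (x @ y)) t k = determined (tape_code x) t k"
  by (simp add: determined_def known_append[OF assms])

lemma count_append:
  assumes "pfst (sim (tape_code x) t) \<noteq> 0"
  shows "count (tape_code (x @ y)) t = count (tape_code x) t"
  by (simp add: count_def determined_append[OF assms])

lemma assemble_append:
  assumes "pfst (sim (tape_code x) t) \<noteq> 0"
  shows "assemble (tape_code (x @ y)) t = assemble (tape_code x) t"
  unfolding assemble_def determined_append[OF assms] known_append[OF assms] ..

text \<open>Appended bits lengthen the tape and its unread part equally, so the balance is
  unchanged.\<close>

lemma critical_append:
  assumes "pfst (sim (tape_code x) t) \<noteq> 0"
  shows "critical m (tape_code (x @ y)) t = critical m (tape_code x) t"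
  using assms sim_append[OF assms] config_code_simps(3)[of "run U x t"]
  by (simp add: critical_def count_append[OF assms] tape_length_tape_code sim_tape_code add.assoc)

lemma first_critical_eq:
  assumes "critical m v i" "\<forall>j<i. \<not> critical m v j" "i \<le> t"
  shows "first_critical m v t = i"
proof -
  have "{..<Suc t} \<inter> {k. \<forall>j<Suc k. \<not> critical m v j} = {..<i}"
    using assms by (auto simp: not_le less_Suc_eq_le)
  then show ?thesis
    unfolding first_critical_def by (simp del: sum.lessThan_Suc)
qed

lemma first_critical_eq_Suc:
  assumes "\<forall>j\<le>t. \<not> critical m v j"
  shows "first_critical m v t = Suc t"
proof -
  have "{..<Suc t} \<inter> {k. \<forall>j<Suc k. \<not> critical m v j} = {..<Suc t}"
    using assms by auto
  then show ?thesis
    unfolding first_critical_def by (simp del: sum.lessThan_Suc)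
qed

text \<open>\<open>q\<close> lists the digits at the undetermined positions in increasing order;
  \<open>r\<close> is what follows on the tape. Digits 0 to \<open>n - 1\<close> give the floor of
  \<open>2 ^ (n - 1) * \<omega>\<close>; the form \<open>2 ^ n * \<omega> / 2\<close> covers
  \<open>n = 0\<close>, where the floor is 0 because \<open>\<omega> < 2\<close>.\<close>

lemma assemble_digits:
  assumes "0 \<le> \<omega>" "\<omega> < 2"
    and "\<And>k. determined v t k \<Longrightarrow> known v t k 1 \<longleftrightarrow> binary_digit \<omega> k"
  shows "\<exists>q. length q = card {k. k < n \<and> \<not> determined v t k} \<and>
    (\<forall>r. assemble v t (tape_code (q @ r)) n = pair (nat \<lfloor>2 ^ n * \<omega> / 2\<rfloor>) (tape_code r))"
proof (induction n)
  case 0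
  have "\<lfloor>\<omega> / 2\<rfloor> = 0"
    using assms(1,2) by (simp add: floor_eq_iff)
  then show ?case
    by (simp add: assemble_def)
next
  case (Suc n)
  then obtain q where q: "length q = card {k. k < n \<and> \<not> determined v t k}"
    "\<And>r. assemble v t (tape_code (q @ r)) n = pair (nat \<lfloor>2 ^ n * \<omega> / 2\<rfloor>) (tape_code r)"
    by blast
  have half: "\<lfloor>2 ^ n * \<omega> / 2\<rfloor> = \<lfloor>2 ^ n * \<omega>\<rfloor> div 2"
    using floor_divide_real_eq_div[of 2 "2 ^ n * \<omega>"] by simp
  have "0 \<le> \<lfloor>2 ^ n * \<omega>\<rfloor>"
    using assms(1) by simp
  then have digit: "nat \<lfloor>2 ^ n * \<omega>\<rfloor> = 2 * nat \<lfloor>2 ^ n * \<omega> / 2\<rfloor> + of_bool (binary_digit \<omega> n)"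
    by (simp add: half binary_digit_def nat_eq_iff of_bool_odd_eq_mod_2 pos_imp_zdiv_nonneg_iff)
  have rec: "assemble v t p (Suc n) =
      (if determined v t n then pair (2 * pfst (assemble v t p n) + of_bool (known v t n 1)) (psnd (assemble v t p n))
       else pair (2 * pfst (assemble v t p n) + psnd (assemble v t p n) mod 2) (psnd (assemble v t p n) div 2))" for p
    by (simp add: assemble_def)
  show ?case
  proof (cases "determined v t n")
    case True
    then have "{k. k < Suc n \<and> \<not> determined v t k} = {k. k < n \<and> \<not> determined v t k}"
      by (auto simp: less_Suc_eq)
    then show ?thesis
      using q True assms(3)[OF True] by (intro exI[of _ q]) (simp add: rec digit)
  next
    case False
    then have "{k. k < Suc n \<and> \<not> determined v t k} = insert n {k. k < n \<and> \<not> determined v t k}"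
      by (auto simp: less_Suc_eq)
    then show ?thesis
      using q False
      by (intro exI[of _ "q @ [binary_digit \<omega> n]"]) (simp add: rec digit)
  qed
qed

lemma decision_not_critical:
  assumes "\<forall>j\<le>t. \<not> critical m v j"
  shows "decision m v t = (if pfst (sim v t) = 0 then 1 else 0)"
  by (simp add: decision_def first_critical_eq_Suc[OF assms])

text \<open>On \<open>u\<close> alone the simulated \<open>U\<close> must run out of bits by stage
  \<open>t\<close>, and until a critical stage this is what makes the machine read.\<close>

lemma reads_on_starved:
  assumes "\<forall>i<t. \<not> critical m (tape_code (u @ b # y)) i"
    and "unread (run U (u @ b # y) t) = []"
  shows "reads_on m u"
proof -
  have "status (run U u t) = Starved"
  proof (rule ccontr)
    assume "status (run U u t) \<noteq> Starved"
    from run_append[OF this, of "b # y"] assms(2) show False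
      by (cases "run U u t") simp
  qed
  then have "pfst (sim (tape_code u) t) = 0"
    by (simp add: sim_tape_code config_code_simps)
  define s where "s = (LEAST s. pfst (sim (tape_code u) s) = 0)"
  have s: "pfst (sim (tape_code u) s) = 0" "s \<le> t"
    unfolding s_def using \<open>pfst (sim (tape_code u) t) = 0\<close> by (rule LeastI, rule Least_le)
  have active: "pfst (sim (tape_code u) i) \<noteq> 0" if "i < s" for i
    using that not_less_Least[of i "\<lambda>s. pfst (sim (tape_code u) s) = 0"] unfolding s_def by simp
  \<comment> \<open>Before \<open>s\<close> criticality agrees with that on the full tape; at
    \<open>s\<close> itself starvation excludes it.\<close>
  have not_critical: "\<not> critical m (tape_code u) i" if "i \<le> s" for i
  proof (cases "i = s")
    case True
    with s show ?thesis
      by (simp add: critical_def)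
  next
    case False
    with that have "i < s"
      by simp
    with critical_append[OF active, of i m "b # y"] assms(1) s(2) show ?thesis
      by simp
  qed
  have "decision m (tape_code u) s = 1"
    using decision_not_critical[of s m "tape_code u"] not_critical s(1) by simp
  moreover have "decision m (tape_code u) i = 0" if "i < s" for i
    using decision_not_critical[of i m "tape_code u"] not_critical that active by simp
  ultimately show ?thesis
    unfolding reads_on_def by blast
qed

text \<open>The diagonal argument. At its first critical stage \<open>t0\<close>, \<open>U\<close>
  has read \<open>p\<close> completely, so all bits after \<open>p\<close> are free to carry the
  missing digits.\<close>

lemma theory_refuted:
  assumes universal: "\<And>p. same_computation diag p U (\<pi> @ p)"
    and m: "m = pair (tape_code \<pi> - 2 ^ length \<pi>) (length \<pi>)"
    and critical: "critical m (tape_code p) t0" "\<forall>i<t0. \<not> critical m (tape_code p) i"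
    and exhausted: "unread (run U p t0) = []"
    and true: "\<And>k b. k \<ge> 1 \<Longrightarrow> enc k b \<in> set (displayed (run U p t0)) \<Longrightarrow>
      binary_digit (halting_probability U) k = b"
  shows False
proof -
  define \<omega> where "\<omega> = halting_probability U"
  have \<omega>: "0 \<le> \<omega>" "\<omega> < 2"
    using halting_probability_le_1[of U] halting_probability_nonneg[of U] by (simp_all add: \<omega>_def)
  have active: "pfst (sim (tape_code p) t0) \<noteq> 0"
    using critical(1) by (simp add: critical_def)
  note active' = sim_not_starved_mono[OF active]
  have "known (tape_code p) t0 k 1 \<longleftrightarrow> binary_digit \<omega> k" if "determined (tape_code p) t0 k" for k
  proof -
    from that obtain b where "k \<ge> 1" "enc k b \<in> set (displayed (run U p t0))"
      by (auto simp: determined_iff)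
    with known_iff[of k p t0 True] true[of k] show ?thesis
      unfolding \<omega>_def by (cases b) auto
  qed
  from assemble_digits[OF \<omega> this, of "Suc t0"]
  obtain q where q: "length q = card {k. k < Suc t0 \<and> \<not> determined (tape_code p) t0 k}"
    and "\<forall>r. assemble (tape_code p) t0 (tape_code (q @ r)) (Suc t0)
      = pair (nat \<lfloor>2 ^ Suc t0 * \<omega> / 2\<rfloor>) (tape_code r)"
    by blast
  from this(2)[THEN spec, of "[]"]
  have assembled: "assemble (tape_code p) t0 (tape_code q) (Suc t0)
      = pair (nat \<lfloor>2 ^ Suc t0 * \<omega> / 2\<rfloor>) (tape_code [])"
    by (simp only: append_Nil2)
  \<comment> \<open>Positions 0 to \<open>t0\<close> split into determined and undetermined
    ones.\<close>
  have "count (tape_code p) t0 + length q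
      = card ({k. k \<le> t0 \<and> determined (tape_code p) t0 k} \<union> {k. k < Suc t0 \<and> \<not> determined (tape_code p) t0 k})"
    unfolding count_eq q by (rule card_Un_disjoint[symmetric]) auto
  also have "{k. k \<le> t0 \<and> determined (tape_code p) t0 k} \<union> {k. k < Suc t0 \<and> \<not> determined (tape_code p) t0 k} = {..t0}"
    by auto
  finally have length_q: "count (tape_code p) t0 + length q = Suc t0"
    by simp
  have psnd: "psnd (sim (tape_code (p @ r)) t0) = tape_code r" for r
    using sim_append(2)[OF active, of r] exhausted by simp
  \<comment> \<open>Up to \<open>t0\<close>, \<open>U\<close> does not look beyond \<open>p\<close>,
    so bits after \<open>p\<close> cannot shift the first critical stage.\<close>
  have critical': "critical m (tape_code (p @ r)) i \<longleftrightarrow> i = t0" if "i \<le> t0" for r i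
    using critical_append[OF active'[OF that]] critical that by (cases "i = t0") auto
  have early: "decision m (tape_code (p @ r)) t = 0" if "t < t0" for r t
    using decision_not_critical[of t m "tape_code (p @ r)"] critical' that
      sim_append(1)[OF active'[of t], of r] active'[of t] by simp
  have late: "decision m (tape_code (p @ r)) t = final_decision m (tape_code (p @ r)) t t0"
    if "t0 \<le> t" for r t
    using first_critical_eq[of m "tape_code (p @ r)" t0 t] critical' that by (simp add: decision_def)
  \<comment> \<open>Inside \<open>p\<close> a bit is requested because the simulated
    \<open>U\<close> starves, beyond \<open>p\<close> because digits are still missing.\<close>
  have reads: "\<forall>u b y. p @ q = u @ b # y \<longrightarrow> reads_on m u"
  proof (intro allI impI)
    fix u b y
    assume eq: "p @ q = u @ b # y"
    show "reads_on m u"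
    proof (cases "length u < length p")
      case True
      have "u = take (length u) p"
        using arg_cong[OF eq, of "take (length u)"] True by simp
      with id_take_nth_drop[OF True] obtain c z where "p = u @ c # z"
        by metis
      with critical(2) exhausted show ?thesis
        using reads_on_starved[of t0 m u c z] by simp
    next
      case False
      have "take (length p) u = p"
        using arg_cong[OF eq, of "take (length p)"] False by simp
      then obtain r where u: "u = p @ r"
        by (metis append_take_drop_id)
      with eq have "length r < length q"
        by simp
      then have "decision m (tape_code (p @ r)) t0 = 1"
        unfolding late[OF order_refl] final_decision_def psnd count_append[OF active] tape_length_tape_code
        using length_q by simp
      moreover have "\<forall>i<t0. decision m (tape_code (p @ r)) i = 0"
        using early by blast
      ultimately have "reads_on m (p @ r)"
        unfolding reads_on_def by blast
      with u show ?thesis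
        by simp
    qed
  qed
  define x where "x = p @ q"
  define X where "X = \<pi> @ replicate m False @ True # x"
  \<comment> \<open>With \<open>q\<close> complete, only the approximation test and the test whether
    \<open>X\<close> has halted remain.\<close>
  have late_x: "decision m (tape_code x) t =
      (if nat \<lfloor>2 ^ t0 * \<omega>\<rfloor> * 2 ^ t < tapes t * 2 ^ t0 + 2 ^ t \<and> \<not> halted_within U X t then 2 else 0)"
    if "t0 \<le> t" for t
  proof -
    have "pfst (sim (own_program m (tape_code (p @ q))) t) = 1 \<longleftrightarrow> halted_within U X t"
      unfolding own_program_eq[OF m] sim_tape_code config_code_simps halted_within_def X_def x_def ..
    then show ?thesis
      unfolding x_def late[OF that] final_decision_def psnd count_append[OF active]
        assemble_append[OF active] assembled tape_length_tape_code
      using length_q by simp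
  qed
  \<comment> \<open>The integer test says that the approximation at time \<open>t\<close> exceeds
    \<open>(J - 1) / 2 ^ t0\<close>, where \<open>J\<close> is the floor of
    \<open>2 ^ t0 * \<omega>\<close>.\<close>
  have threshold: "nat \<lfloor>2 ^ t0 * \<omega>\<rfloor> * 2 ^ t < tapes t * 2 ^ t0 + 2 ^ t \<longleftrightarrow>
      \<lfloor>2 ^ t0 * \<omega>\<rfloor> < 2 ^ t0 * (card (halting_tapes U t) / 2 ^ t) + 1" for t
  proof -
    have "nat \<lfloor>2 ^ t0 * \<omega>\<rfloor> * 2 ^ t < tapes t * 2 ^ t0 + 2 ^ t \<longleftrightarrow>
        real (nat \<lfloor>2 ^ t0 * \<omega>\<rfloor> * 2 ^ t) < real (tapes t * 2 ^ t0 + 2 ^ t)"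
      by (simp only: of_nat_less_iff)
    also have "\<dots> \<longleftrightarrow> real (nat \<lfloor>2 ^ t0 * \<omega>\<rfloor>) * 2 ^ t < real (tapes t) * 2 ^ t0 + 2 ^ t"
      by simp
    also have "real (nat \<lfloor>2 ^ t0 * \<omega>\<rfloor>) = \<lfloor>2 ^ t0 * \<omega>\<rfloor>"
      using \<omega>(1) by simp
    finally show ?thesis
      by (simp add: tapes_eq field_simps)
  qed
  obtain t1 where t1: "\<And>t. t \<ge> t1 \<Longrightarrow> \<omega> - 1 / 2 ^ t0 < card (halting_tapes U t) / 2 ^ t"
    using halting_probability_approx[of "1 / 2 ^ t0" U] by (auto simp: \<omega>_def)
  \<comment> \<open>Late enough both for \<open>late_x\<close> to apply and for the approximation
    test to succeed.\<close>
  define T where "T = max t0 t1"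
  have "\<lfloor>2 ^ t0 * \<omega>\<rfloor> < 2 ^ t0 * (card (halting_tapes U T) / 2 ^ T) + 1"
  proof -
    have "2 ^ t0 * (\<omega> - 1 / 2 ^ t0) < 2 ^ t0 * (card (halting_tapes U T) / 2 ^ T)"
      using t1[of T] by (intro mult_strict_left_mono) (auto simp: T_def)
    then have "2 ^ t0 * \<omega> < 2 ^ t0 * (card (halting_tapes U T) / 2 ^ T) + 1"
      by (simp add: right_diff_distrib)
    then show ?thesis
      using of_int_floor_le[of "2 ^ t0 * \<omega>"] by linarith
  qed
  with threshold have approx_T: "nat \<lfloor>2 ^ t0 * \<omega>\<rfloor> * 2 ^ T < tapes T * 2 ^ t0 + 2 ^ T"
    by blast
  show False
  proof (cases "\<exists>t. decision m (tape_code x) t \<noteq> 0")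
    case True
    then obtain t where t: "decision m (tape_code x) t \<noteq> 0" "\<forall>i<t. decision m (tape_code x) i = 0"
      unfolding exists_least_iff[of "\<lambda>t. decision m (tape_code x) t \<noteq> 0"] by blast
    have "t0 \<le> t"
    proof (rule ccontr)
      assume "\<not> t0 \<le> t"
      with early[of t q] t(1) show False
        by (simp add: x_def)
    qed
    then have *: "nat \<lfloor>2 ^ t0 * \<omega>\<rfloor> * 2 ^ t < tapes t * 2 ^ t0 + 2 ^ t \<and> \<not> halted_within U X t"
      using t(1) late_x[of t] by metis
    then have two: "decision m (tape_code x) t = 2"
      using late_x[OF \<open>t0 \<le> t\<close>] by (simp only: if_True simp_thms)
    from * have low: "\<lfloor>2 ^ t0 * \<omega>\<rfloor> < 2 ^ t0 * (card (halting_tapes U t) / 2 ^ t) + 1"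
      and not_halted: "\<not> halted_within U X t"
      unfolding threshold by blast+
    have "halts_with diag (replicate m False @ True # x) []"
      using diag_halts[OF _ two t(2)] reads by (simp add: x_def)
    with universal have "halts_with U X []"
      unfolding X_def using same_computation_halts_with by blast
    then have "card (halting_tapes U t) / 2 ^ t + (1/2) ^ length X \<le> \<omega>"
      unfolding \<omega>_def using not_halted by (rule uncounted_program_le_halting_probability)
    then have "2 ^ t0 * (card (halting_tapes U t) / 2 ^ t + (1/2) ^ length X) \<le> 2 ^ t0 * \<omega>"
      by (intro mult_left_mono) auto
    \<comment> \<open>\<open>critical\<close> gives
      \<open>length p + m + length \<pi> + 4 \<le> count (tape_code p) t0\<close>, which is
      \<open>t0 + 1 - length q\<close>; the header's final one uses up one more bit.\<close>
    moreover have "length X + 2 \<le> t0"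
    proof -
      have "tape_length (psnd (sim (tape_code p) t0)) = 0" "psnd m = length \<pi>"
        unfolding sim_tape_code config_code_simps exhausted tape_length_tape_code m by simp_all
      with critical(1) length_q show ?thesis
        by (simp add: critical_def X_def x_def tape_length_tape_code)
    qed
    \<comment> \<open>The weight of \<open>X\<close>, scaled by \<open>2 ^ t0\<close>, is at least
      4, whereas the test leaves a gap below 2 between the scaled approximation and
      \<open>2 ^ t0 * \<omega>\<close>.\<close>
    then have scaled: "(2 :: real) ^ (length X + 2) * (1/2) ^ length X \<le> 2 ^ t0 * (1/2) ^ length X"
      by (intro mult_right_mono power_increasing) auto
    moreover have "(2 :: real) ^ (length X + 2) * (1/2) ^ length X = 4"
      by (simp add: power_add flip: power_mult_distrib)
    ultimately show False
      using low scaled real_of_int_floor_add_one_gt[of "2 ^ t0 * \<omega>"]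
      unfolding distrib_left by linarith
  next
    case False
    then have zero: "decision m (tape_code x) t = 0" for t
      by blast
    \<comment> \<open>The approximation test succeeds at \<open>T\<close>, so only an earlier halt
      of \<open>X\<close> can explain the decision 0.\<close>
    have "halted_within U X T"
      using zero[of T] late_x[of T] approx_T unfolding T_def by (metis max.cobounded1 zero_neq_numeral)
    then obtain z where "\<exists>n. status (run U X n) = Halted z"
      by (auto simp: halted_within_def)
    then obtain n where "status (run diag (replicate m False @ True # x) n) = Halted z"
      using universal[of "replicate m False @ True # x"]
      unfolding same_computation_def X_def by blast
    with diag_never_halts[OF _ zero] reads show False
      by (simp add: x_def)
  qed
qed

lemma ex_theory_bound:
  assumes "universal U"
  shows "\<exists>c. \<forall>p T. generates U p T \<longrightarrow>
    (\<forall>k\<ge>1. \<forall>b. enc k b \<in> T \<longrightarrow> binary_digit (halting_probability U) k = b) \<longrightarrow>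
    finite {k. k \<ge> 1 \<and> (\<exists>b. enc k b \<in> T)} \<and>
    card {k. k \<ge> 1 \<and> (\<exists>b. enc k b \<in> T)} \<le> length p + c"
proof -
  obtain \<pi> where \<pi>: "\<And>p. same_computation diag p U (\<pi> @ p)"
    using assms self_delimiting_diag unfolding universal_def by blast
  \<comment> \<open>\<pi> exists only once \<open>diag\<close> is fixed, so \<open>diag\<close>
    learns it from the tape, as the number of zeros in the header.\<close>
  define m where "m = pair (tape_code \<pi> - 2 ^ length \<pi>) (length \<pi>)"
  \<comment> \<open>Exactly the surplus required by \<open>critical\<close>, since
    \<open>psnd m = length \<pi>\<close>.\<close>
  define c where "c = m + length \<pi> + 4"
  have "finite {k. k \<ge> 1 \<and> (\<exists>b. enc k b \<in> T)} \<and>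
      card {k. k \<ge> 1 \<and> (\<exists>b. enc k b \<in> T)} \<le> length p + c"
    if gen: "generates U p T"
      and true: "\<forall>k\<ge>1. \<forall>b. enc k b \<in> T \<longrightarrow> binary_digit (halting_probability U) k = b" for p T
  proof (rule ccontr)
    define S where "S = {k. k \<ge> 1 \<and> (\<exists>b. enc k b \<in> T)}"
    assume "\<not> ?thesis"
    then have "\<not> (finite S \<and> card S \<le> length p + c)"
      by (simp add: S_def)
    then have "\<exists>F\<subseteq>S. finite F \<and> length p + c \<le> card F"
      using infinite_arbitrarily_large[of S "length p + c"] by (cases "finite S") auto
    then obtain F where F: "F \<subseteq> S" "finite F" "length p + c \<le> card F"
      by blast
    have T: "T = (\<Union>n. set (displayed (run U p n)))" and not_starved: "\<And>n. status (run U p n) \<noteq> Starved"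
      using gen by (auto simp: generates_def)
    \<comment> \<open>Besides having seen the displays, \<open>t\<close> must reach the positions
      themselves, as \<open>count\<close> ignores larger ones.\<close>
    have "\<exists>t. \<forall>k\<in>F. k \<le> t \<and> determined (tape_code p) t k"
      using F(2,1)
    proof (induction F)
      case (insert k F)
      then obtain t where t: "\<forall>k\<in>F. k \<le> t \<and> determined (tape_code p) t k"
        by auto
      obtain b n where bn: "k \<ge> 1" "enc k b \<in> set (displayed (run U p n))"
        using insert.prems T by (auto simp: S_def)
      have "k' \<le> max t (max n k) \<and> determined (tape_code p) (max t (max n k)) k'" if "k' \<in> insert k F" for k'
      proof (cases "k' = k")
        case True
        with bn displayed_mono[of n "max t (max n k)" U p] show ?thesis
          by (auto simp: determined_iff subset_iff le_max_iff_disj)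
      next
        case False
        with that t have "k' \<le> t" "determined (tape_code p) t k'"
          by auto
        with displayed_mono[of t "max t (max n k)" U p] show ?thesis
          by (auto simp: determined_iff subset_iff le_max_iff_disj)
      qed
      then show ?case
        by blast
    qed simp
    then obtain t where t: "\<And>k. k \<in> F \<Longrightarrow> k \<le> t \<and> determined (tape_code p) t k"
      by blast
    have "card F \<le> count (tape_code p) t"
      unfolding count_eq by (rule card_mono) (use t in auto)
    then have crit: "critical m (tape_code p) t"
      using F(3) not_starved[of t]
      by (simp add: critical_def tape_length_tape_code sim_tape_code config_code_simps c_def m_def del: not_gr_zero)
    from crit obtain t0 where t0: "critical m (tape_code p) t0" "\<forall>i<t0. \<not> critical m (tape_code p) i"
      using exists_least_iff[of "critical m (tape_code p)"] by blast
    \<comment> \<open>Only the part of \<open>p\<close> read by stage \<open>t0\<close> is kept, so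
      that the tape is exhausted there; no earlier stage is affected.\<close>
    obtain p' where p': "p = p' @ unread (run U p t0)"
      using run_suffix[of p U t0] by blast
    have cut: "run U p' t0 = Config (status (run U p t0)) [] (displayed (run U p t0))"
      by (rule run_cut[where y = "unread (run U p t0)"])
        (use p' not_starved in \<open>auto intro: config.expand\<close>)
    then have "pfst (sim (tape_code p') t0) \<noteq> 0"
      using not_starved[of t0] by (simp add: sim_tape_code config_code_simps del: not_gr_zero)
    then have "critical m (tape_code p') i \<longleftrightarrow> critical m (tape_code p) i" if "i \<le> t0" for i
      using critical_append[OF sim_not_starved_mono[OF _ that], of p' m "unread (run U p t0)"] p' by simp
    with t0 have "critical m (tape_code p') t0" "\<forall>i<t0. \<not> critical m (tape_code p') i"
      by auto
    then show False
    proof (rule theory_refuted[OF \<pi> m_def])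
      show "unread (run U p' t0) = []"
        by (simp add: cut)
      show "binary_digit (halting_probability U) k = b"
        if "k \<ge> 1" "enc k b \<in> set (displayed (run U p' t0))" for k b
        using that true T by (auto simp: cut)
    qed
  qed
  then show ?thesis
    by blast
qed

end

theorem mainTheorem3:
  fixes U :: computer and enc :: "nat \<Rightarrow> bool \<Rightarrow> bits"
  assumes "universal U"
    and "effective_encoding enc"
  shows "\<exists>c::nat. \<forall>(T :: bits set) (N :: nat).
    recursively_enumerable T \<longrightarrow>
    complexity U T = N \<longrightarrow>
    (\<forall>k\<ge>1. \<forall>b. enc k b \<in> T \<longrightarrow> binary_digit (halting_probability U) k = b) \<longrightarrow>
    finite {k. k \<ge> 1 \<and> (\<exists>b. enc k b \<in> T)} \<and>
    card {k. k \<ge> 1 \<and> (\<exists>b. enc k b \<in> T)} \<le> N + c"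
proof -
  obtain e where "recursive e" "\<And>k b. k \<ge> 1 \<Longrightarrow> e (pair k (of_bool b)) = bits_code (enc k b)"
    using assms(2) unfolding effective_encoding_def by blast
  moreover have "self_delimiting_computer U"
    using assms(1) by (simp add: universal_def)
  ultimately interpret omega_theory U enc e
    by unfold_locales
  obtain c where c: "\<And>p T. generates U p T \<Longrightarrow>
      (\<forall>k\<ge>1. \<forall>b. enc k b \<in> T \<longrightarrow> binary_digit (halting_probability U) k = b) \<Longrightarrow>
      finite {k. k \<ge> 1 \<and> (\<exists>b. enc k b \<in> T)} \<and>
      card {k. k \<ge> 1 \<and> (\<exists>b. enc k b \<in> T)} \<le> length p + c"
    using ex_theory_bound[OF assms(1)] by blast
  show ?thesis
  proof (intro exI[of _ c] allI impI)
    fix T :: "bits set" and N :: nat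
    assume "recursively_enumerable T" and N: "complexity U T = N"
      and true: "\<forall>k\<ge>1. \<forall>b. enc k b \<in> T \<longrightarrow> binary_digit (halting_probability U) k = b"
    \<comment> \<open>A shortest program for \<open>T\<close> turns the bound in
      \<open>length p\<close> into one in \<open>N\<close>.\<close>
    with complexity_attained[OF assms(1)] obtain p where "length p = N" "generates U p T"
      by blast
    with c[of p T] true show "finite {k. k \<ge> 1 \<and> (\<exists>b. enc k b \<in> T)} \<and>
        card {k. k \<ge> 1 \<and> (\<exists>b. enc k b \<in> T)} \<le> N + c"
      by simp
  qed
qed

end
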